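(* The function $H$ is a "norm" on each $S(n)$ and also on $S(\infty)$, i.e.: (i) $H(e)=0$; (ii) $H(\sigma)=H(\sigma^{-1})$ for all $\sigma\in S(\infty)$; (iii) $H(\sigma^{-1}\tau)\le H(\sigma)+H(\tau)$ for all $\sigma,\tau\in S(\infty)$; (iv) the function $d(\sigma,\tau)=H(\sigma^{-1}\tau)$, $\sigma,\tau\in S(\infty)$, is a left-invariant metric on the group $S(\infty)$.
   Context: $S(n)$ is the group of permutations of $\{1,\dots,n\}$, embedded in $S(n+1)$ as the permutations fixing $n+1$, and $S(\infty)=\bigcup_nS(n)$; $e$ is the identity. For $\sigma\in S(n)$ let $j(\sigma)=\{(k,\,2n+1-\sigma(k)):k=1,\dots,n\}$, a pair-partition of $\{1,\dots,2n\}$ (a partition into blocks of size two, written $(i,j)$ with $i<j$). Two blocks $(i_1,j_1),(i_2,j_2)$ cross if $i_1<i_2<j_1<j_2$ or $i_2<i_1<j_2<j_1$. A block is a singleton if it crosses no other block, and $h_n(\sigma)$ is the number of singletons of $j(\sigma)$. The function $H:S(\infty)\to\mathbb{R}$ is defined by $H(\sigma)=n-h_n(\sigma)$ for $\sigma\in S(n)$; this value does not depend on the choice of $n$ with $\sigma\in S(n)$. *)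

theory Defs
  imports "HOL-Combinatorics.Permutations" "HOL-Analysis.Abstract_Metric_Spaces"
begin

definition symgrp :: "nat \<Rightarrow> (nat \<Rightarrow> nat) set" where
  "symgrp n = {\<sigma>. \<sigma> permutes {1..n}}"

text \<open>Since \<open>permutes\<close> makes a permutation the identity off its carrier, the embeddings
  \<open>S(n) \<subseteq> S(n + 1)\<close> are plain inclusions.\<close>

definition symgrp_inf :: "(nat \<Rightarrow> nat) set" where
  "symgrp_inf = (\<Union>n. symgrp n)"

text \<open>A block is an ordered pair \<open>(i, j)\<close> with \<open>i < j\<close>; for \<open>\<sigma>\<close> in \<open>symgrp n\<close> this holds
  automatically below, as \<open>k \<le> n < 2 * n + 1 - \<sigma> k\<close> (so the subtraction never truncates).\<close>

definition pair_partition_of :: "nat \<Rightarrow> (nat \<Rightarrow> nat) \<Rightarrow> (nat \<times> nat) set" where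
  "pair_partition_of n \<sigma> = (\<lambda>k. (k, 2 * n + 1 - \<sigma> k)) ` {1..n}"

fun crosses :: "nat \<times> nat \<Rightarrow> nat \<times> nat \<Rightarrow> bool" where
  "crosses (i1, j1) (i2, j2) \<longleftrightarrow>
     (i1 < i2 \<and> i2 < j1 \<and> j1 < j2) \<or> (i2 < i1 \<and> i1 < j2 \<and> j2 < j1)"

definition singleton_blocks :: "(nat \<times> nat) set \<Rightarrow> (nat \<times> nat) set" where
  "singleton_blocks P = {b \<in> P. \<forall>c \<in> P. \<not> crosses b c}"

definition num_singletons :: "nat \<Rightarrow> (nat \<Rightarrow> nat) \<Rightarrow> nat" where
  "num_singletons n \<sigma> = card (singleton_blocks (pair_partition_of n \<sigma>))"

text \<open>The least admissible \<open>n\<close> is used to fix a value; the lemma \<open>perm_norm_eq\<close> below shows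
  that every admissible \<open>n\<close> gives the same one. Outside \<open>symgrp_inf\<close> the value is junk.\<close>

definition perm_norm :: "(nat \<Rightarrow> nat) \<Rightarrow> real" where
  "perm_norm \<sigma> = (let n = (LEAST n. \<sigma> \<in> symgrp n) in real n - real (num_singletons n \<sigma>))"

text \<open>The library locale \<open>Metric_space\<close> demands nonnegativity and symmetry of the distance on
  the whole type, not only on the carrier, hence the value \<open>0\<close> outside \<open>symgrp_inf\<close>.\<close>

definition perm_dist :: "(nat \<Rightarrow> nat) \<Rightarrow> (nat \<Rightarrow> nat) \<Rightarrow> real" where
  "perm_dist \<sigma> \<tau> = (if \<sigma> \<in> symgrp_inf \<and> \<tau> \<in> symgrp_inf then perm_norm (inv \<sigma> \<circ> \<tau>) else 0)"

lemma num_singletons_alt: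
  assumes "\<sigma> \<in> symgrp n"
  shows "num_singletons n \<sigma> =
    card {k \<in> {1..n}. \<forall>l \<in> {1..n}. \<not> (k < l \<and> \<sigma> l < \<sigma> k) \<and> \<not> (l < k \<and> \<sigma> k < \<sigma> l)}"
    (is "_ = card ?A")
proof -
  let ?f = "\<lambda>k. (k, 2 * n + 1 - \<sigma> k)"
  have le: "\<sigma> k \<le> n" if "k \<in> {1..n}" for k
    using assms that permutes_in_image[of \<sigma> "{1..n}" k] by (auto simp: symgrp_def)
  have cr: "crosses (?f k) (?f l) \<longleftrightarrow> (k < l \<and> \<sigma> l < \<sigma> k) \<or> (l < k \<and> \<sigma> k < \<sigma> l)"
    if "k \<in> {1..n}" "l \<in> {1..n}" for k l
    using le[OF that(1)] le[OF that(2)] that by auto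
  have "singleton_blocks (pair_partition_of n \<sigma>) =
      ?f ` {k \<in> {1..n}. \<forall>l \<in> {1..n}. \<not> crosses (?f k) (?f l)}"
    unfolding singleton_blocks_def pair_partition_of_def by blast
  also have "{k \<in> {1..n}. \<forall>l \<in> {1..n}. \<not> crosses (?f k) (?f l)} = ?A"
    using cr by blast
  finally have "singleton_blocks (pair_partition_of n \<sigma>) = ?f ` ?A" .
  moreover have "inj_on ?f ?A" by (auto simp: inj_on_def)
  ultimately show ?thesis unfolding num_singletons_def by (simp add: card_image)
qed

lemma symgrp_Suc: "\<sigma> \<in> symgrp n \<Longrightarrow> \<sigma> \<in> symgrp (Suc n)"
  unfolding symgrp_def by (auto intro: permutes_subset)

lemma num_singletons_Suc:
  assumes "\<sigma> \<in> symgrp n"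
  shows "num_singletons (Suc n) \<sigma> = Suc (num_singletons n \<sigma>)"
proof -
  define A where "A m = {k \<in> {1..m}. \<forall>l \<in> {1..m}.
    \<not> (k < l \<and> \<sigma> l < \<sigma> k) \<and> \<not> (l < k \<and> \<sigma> k < \<sigma> l)}" for m
  have le: "\<sigma> k \<le> n" if "k \<in> {1..n}" for k
    using assms that permutes_in_image[of \<sigma> "{1..n}" k] by (auto simp: symgrp_def)
  have fx: "\<sigma> (Suc n) = Suc n"
    using assms by (auto simp: symgrp_def permutes_def)
  have iv: "{1..Suc n} = insert (Suc n) {1..n}" by auto
  have "A (Suc n) = insert (Suc n) (A n)"
    unfolding A_def iv using le fx by fastforce
  moreover have "finite (A n)" "Suc n \<notin> A n" by (auto simp: A_def)
  ultimately have "card (A (Suc n)) = Suc (card (A n))" by simp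
  then show ?thesis
    using num_singletons_alt[OF assms] num_singletons_alt[OF symgrp_Suc[OF assms]]
    by (simp add: A_def)
qed

lemma perm_norm_eq:
  assumes "\<sigma> \<in> symgrp n"
  shows "perm_norm \<sigma> = real n - real (num_singletons n \<sigma>)"
proof -
  let ?m = "LEAST n. \<sigma> \<in> symgrp n"
  have m: "\<sigma> \<in> symgrp ?m" using assms by (rule LeastI)
  have "?m \<le> n" using assms by (rule Least_le)
  then have "\<sigma> \<in> symgrp n \<and>
    real n - real (num_singletons n \<sigma>) = real ?m - real (num_singletons ?m \<sigma>)"
    by (induction n rule: dec_induct) (use m in \<open>auto simp: symgrp_Suc num_singletons_Suc\<close>)
  then show ?thesis by (simp add: perm_norm_def Let_def)
qed

end

theory Submission
  imports Defs
begin

text \<open>The block of \<open>k\<close> is a singleton iff \<open>k\<close> takes part in no inversion of \<open>\<sigma>\<close>, and this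
  happens iff \<open>\<sigma>\<close> fixes \<open>k\<close> and preserves \<open>{..<k}\<close>. So \<open>H \<sigma>\<close> counts the points without the latter
  property. The property passes to inverses, and from \<open>\<sigma>\<close> and \<open>\<tau>\<close> to products; hence the set of
  points counted for \<open>\<sigma>\<^sup>-\<^sup>1 \<tau>\<close> lies in the union of the sets for \<open>\<sigma>\<close> and \<open>\<tau>\<close>.\<close>

definition cut_points :: "(nat \<Rightarrow> nat) \<Rightarrow> nat set" where
  "cut_points \<sigma> = {k. \<sigma> k = k \<and> (\<forall>l. \<sigma> l < k \<longleftrightarrow> l < k)}"

lemma cut_pointsI:
  "\<sigma> k = k \<Longrightarrow> (\<And>l. \<sigma> l < k \<longleftrightarrow> l < k) \<Longrightarrow> k \<in> cut_points \<sigma>"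
  unfolding cut_points_def by blast

lemma cut_points_fixed: "k \<in> cut_points \<sigma> \<Longrightarrow> \<sigma> k = k"
  unfolding cut_points_def by blast

lemma cut_points_less_iff: "k \<in> cut_points \<sigma> \<Longrightarrow> \<sigma> l < k \<longleftrightarrow> l < k"
  unfolding cut_points_def by blast

lemma cut_points_id: "cut_points id = UNIV"
  by (simp add: cut_points_def)

text \<open>Substituting \<open>inv f l\<close> for \<open>l\<close> in the equivalence that defines
  a cut point of \<open>f\<close> gives the one for \<open>inv f\<close>. This yields one inclusion
  for every bijection; applied to both \<open>\<sigma>\<close> and \<open>inv \<sigma>\<close>, it
  gives equality.\<close>

lemma cut_points_inv:
  assumes "bij \<sigma>"
  shows "cut_points (inv \<sigma>) = cut_points \<sigma>"
proof -
  have sub: "cut_points f \<subseteq> cut_points (inv f)" if "bij f" for f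
  proof
    fix k assume k: "k \<in> cut_points f"
    show "k \<in> cut_points (inv f)"
    proof (rule cut_pointsI)
      show "inv f k = k"
        using cut_points_fixed[OF k] by (rule inv_f_eq[OF bij_is_inj[OF that]])
      show "inv f l < k \<longleftrightarrow> l < k" for l
        using cut_points_less_iff[OF k, of "inv f l"]
        unfolding surj_f_inv_f[OF bij_is_surj[OF that]] by (rule sym)
    qed
  qed
  from sub[OF bij_imp_bij_inv[OF assms]] sub[OF assms] show ?thesis
    unfolding inv_inv_eq[OF assms] by (rule subset_antisym)
qed

lemma cut_points_comp: "cut_points \<sigma> \<inter> cut_points \<tau> \<subseteq> cut_points (\<sigma> \<circ> \<tau>)"
proof
  fix k assume "k \<in> cut_points \<sigma> \<inter> cut_points \<tau>"
  then have k: "k \<in> cut_points \<sigma>" "k \<in> cut_points \<tau>" by simp_all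
  show "k \<in> cut_points (\<sigma> \<circ> \<tau>)"
    by (rule cut_pointsI) (simp_all add: cut_points_fixed[OF k(1)] cut_points_fixed[OF k(2)]
        cut_points_less_iff[OF k(1)] cut_points_less_iff[OF k(2)])
qed

text \<open>If \<open>k\<close> is in no inversion, injectivity turns the weak comparisons with
  \<open>\<sigma> k\<close> into strict ones, so \<open>\<sigma>\<close> respects the order relative
  to \<open>k\<close>. That \<open>\<sigma>\<close> also fixes \<open>k\<close> then follows by
  counting the points below.\<close>

lemma no_inversion_iff_cut_point:
  assumes "bij \<sigma>"
  shows "(\<forall>l. \<not> (k < l \<and> \<sigma> l < \<sigma> k) \<and> \<not> (l < k \<and> \<sigma> k < \<sigma> l)) \<longleftrightarrow> k \<in> cut_points \<sigma>"
    (is "?L \<longleftrightarrow> _")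
proof
  assume L: ?L
  have iff: "\<sigma> l < \<sigma> k \<longleftrightarrow> l < k" for l
    using spec[OF L, of l] inj_eq[OF bij_is_inj[OF assms], of l k] by linarith
  \<comment> \<open>By surjectivity the image is a full initial segment; comparing cardinalities of
    the two sides forces \<open>\<sigma> k = k\<close>.\<close>
  have "\<sigma> ` {..<k} = {..<\<sigma> k}"
  proof (intro equalityI subsetI)
    fix y assume "y \<in> {..<\<sigma> k}"
    moreover obtain l where "y = \<sigma> l" using assms by (meson bij_pointE)
    ultimately show "y \<in> \<sigma> ` {..<k}" using iff by auto
  qed (use iff in auto)
  moreover have "card (\<sigma> ` {..<k}) = k"
    using inj_on_subset[OF bij_is_inj[OF assms]] by (simp add: card_image)
  ultimately have "\<sigma> k = k" by simp
  with iff show "k \<in> cut_points \<sigma>" by (intro cut_pointsI) simp_all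
next
  assume k: "k \<in> cut_points \<sigma>"
  show ?L
  proof
    show "\<not> (k < l \<and> \<sigma> l < \<sigma> k) \<and> \<not> (l < k \<and> \<sigma> k < \<sigma> l)" for l
      using cut_points_less_iff[OF k, of l] cut_points_fixed[OF k] by linarith
  qed
qed

lemma symgrp_inf_bij: "\<sigma> \<in> symgrp_inf \<Longrightarrow> bij \<sigma>"
  by (auto simp: symgrp_inf_def symgrp_def permutes_bij)

lemma symgrp_subset_inf: "symgrp n \<subseteq> symgrp_inf"
  by (auto simp: symgrp_inf_def)

lemma symgrp_mono: "m \<le> n \<Longrightarrow> symgrp m \<subseteq> symgrp n"
  by (auto simp: symgrp_def intro: permutes_subset)

lemma symgrp_comp: "\<sigma> \<in> symgrp n \<Longrightarrow> \<tau> \<in> symgrp n \<Longrightarrow> \<sigma> \<circ> \<tau> \<in> symgrp n"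
  by (simp add: symgrp_def permutes_compose)

lemma symgrp_inv: "\<sigma> \<in> symgrp n \<Longrightarrow> inv \<sigma> \<in> symgrp n"
  by (simp add: symgrp_def permutes_inv)

lemma symgrp_inf_inv: "\<sigma> \<in> symgrp_inf \<Longrightarrow> inv \<sigma> \<in> symgrp_inf"
  by (auto simp: symgrp_inf_def intro: symgrp_inv)

lemma symgrp_inf_comp:
  assumes "\<sigma> \<in> symgrp_inf" "\<tau> \<in> symgrp_inf"
  shows "\<sigma> \<circ> \<tau> \<in> symgrp_inf"
proof -
  obtain m n where "\<sigma> \<in> symgrp m" "\<tau> \<in> symgrp n"
    using assms by (auto simp: symgrp_inf_def)
  then have "\<sigma> \<in> symgrp (max m n)" "\<tau> \<in> symgrp (max m n)"
    using symgrp_mono[of m "max m n"] symgrp_mono[of n "max m n"] by auto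
  from symgrp_comp[OF this] show ?thesis
    using symgrp_subset_inf by blast
qed

text \<open>A point outside \<open>{1..n}\<close> is 0 or exceeds \<open>n\<close>, so all of
  \<open>{1..n}\<close> lies on one side of it. Since \<open>\<sigma>\<close> moves points only
  within \<open>{1..n}\<close>, no comparison with that point changes.\<close>

lemma compl_cut_points_subset:
  assumes "\<sigma> \<in> symgrp n"
  shows "- cut_points \<sigma> \<subseteq> {1..n}"
proof
  fix k assume k: "k \<in> - cut_points \<sigma>"
  have p: "\<sigma> permutes {1..n}" using assms by (simp add: symgrp_def)
  show "k \<in> {1..n}"
  proof (rule ccontr)
    assume nk: "k \<notin> {1..n}"
    then have "\<sigma> k = k" using p by (simp add: permutes_not_in)
    moreover have "\<sigma> l < k \<longleftrightarrow> l < k" for l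
      using nk permutes_in_image[OF p, of l] permutes_not_in[OF p, of l]
      by (cases "l \<in> {1..n}") auto
    ultimately show False using k cut_pointsI by blast
  qed
qed

text \<open>This form of \<open>H\<close> no longer mentions \<open>n\<close>, so permutations from
  different \<open>S(n)\<close> can be compared directly. Finiteness is recorded as well because
  \<open>card\<close> is 0 on infinite sets.\<close>

lemma perm_norm_eq_card:
  assumes "\<sigma> \<in> symgrp_inf"
  shows "perm_norm \<sigma> = real (card (- cut_points \<sigma>))" "finite (- cut_points \<sigma>)"
proof -
  obtain n where n: "\<sigma> \<in> symgrp n" using assms by (auto simp: symgrp_inf_def)
  have p: "\<sigma> permutes {1..n}" using n by (simp add: symgrp_def)
  have sub: "- cut_points \<sigma> \<subseteq> {1..n}" by (rule compl_cut_points_subset[OF n])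
  have "(\<forall>l \<in> {1..n}. \<not> (k < l \<and> \<sigma> l < \<sigma> k) \<and> \<not> (l < k \<and> \<sigma> k < \<sigma> l)) \<longleftrightarrow> k \<in> cut_points \<sigma>"
    if k: "k \<in> {1..n}" for k
  proof -
    \<comment> \<open>Blocks exist only for indices in \<open>{1..n}\<close>, whereas cut points
      refer to all naturals. Indices outside the range are fixed and form no inversion with
      \<open>k\<close>, so the two quantifiers agree.\<close>
    have "\<not> (k < l \<and> \<sigma> l < \<sigma> k) \<and> \<not> (l < k \<and> \<sigma> k < \<sigma> l)" if "l \<notin> {1..n}" for l
      using k that permutes_in_image[OF p, of k] permutes_not_in[OF p that] by auto
    then show ?thesis
      using no_inversion_iff_cut_point[OF permutes_bij[OF p], of k] by blast
  qed
  then have "num_singletons n \<sigma> = card ({1..n} - - cut_points \<sigma>)"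
    by (subst num_singletons_alt[OF n]) (rule arg_cong[of _ _ card], blast)
  also have "\<dots> = n - card (- cut_points \<sigma>)"
    using card_Diff_subset[OF _ sub] finite_subset[OF sub] by simp
  finally show "perm_norm \<sigma> = real (card (- cut_points \<sigma>))"
    using card_mono[OF _ sub] by (simp add: perm_norm_eq[OF n] of_nat_diff)
  show "finite (- cut_points \<sigma>)" using sub by (rule finite_subset) simp
qed

lemma perm_norm_id: "perm_norm id = 0"
proof -
  have "id \<in> symgrp 0" by (simp add: symgrp_def permutes_id)
  then show ?thesis
    using perm_norm_eq_card(1)[of id] symgrp_subset_inf by (auto simp: cut_points_id)
qed

lemma perm_norm_inv:
  "\<sigma> \<in> symgrp_inf \<Longrightarrow> perm_norm (inv \<sigma>) = perm_norm \<sigma>"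
  by (simp add: perm_norm_eq_card symgrp_inf_inv cut_points_inv symgrp_inf_bij)

text \<open>Stated for a plain product so that it serves twice: with invariance under inversion it
  gives (iii), and it also gives the triangle inequality.\<close>

lemma perm_norm_comp_le:
  assumes "\<sigma> \<in> symgrp_inf" "\<tau> \<in> symgrp_inf"
  shows "perm_norm (\<sigma> \<circ> \<tau>) \<le> perm_norm \<sigma> + perm_norm \<tau>"
proof -
  have "card (- cut_points (\<sigma> \<circ> \<tau>)) \<le> card (- cut_points \<sigma> \<union> - cut_points \<tau>)"
    using cut_points_comp by (intro card_mono) (auto simp: perm_norm_eq_card(2) assms)
  also have "\<dots> \<le> card (- cut_points \<sigma>) + card (- cut_points \<tau>)"
    by (rule card_Un_le)
  finally show ?thesis
    by (simp add: perm_norm_eq_card(1) assms symgrp_inf_comp)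
qed

text \<open>A finite complement of cardinality 0 is empty, so every point is a cut point and in
  particular fixed.\<close>

lemma perm_norm_eq_0_iff:
  assumes "\<sigma> \<in> symgrp_inf"
  shows "perm_norm \<sigma> = 0 \<longleftrightarrow> \<sigma> = id"
proof
  assume "perm_norm \<sigma> = 0"
  then have "cut_points \<sigma> = UNIV"
    using perm_norm_eq_card[OF assms] by auto
  then show "\<sigma> = id" by (intro ext) (simp add: cut_points_fixed)
qed (simp add: perm_norm_id)

lemma perm_dist_eq:
  "\<sigma> \<in> symgrp_inf \<Longrightarrow> \<tau> \<in> symgrp_inf \<Longrightarrow> perm_dist \<sigma> \<tau> = perm_norm (inv \<sigma> \<circ> \<tau>)"
  by (simp add: perm_dist_def)

lemma inv_comp_comp:
  assumes "bij \<rho>" "bij \<sigma>"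
  shows "inv (\<rho> \<circ> \<sigma>) \<circ> (\<rho> \<circ> \<tau>) = inv \<sigma> \<circ> \<tau>"
  using assms by (simp add: o_inv_distrib fun_eq_iff inv_f_f bij_is_inj)

lemma perm_dist_left_invariant:
  assumes "\<rho> \<in> symgrp_inf" "\<sigma> \<in> symgrp_inf" "\<tau> \<in> symgrp_inf"
  shows "perm_dist (\<rho> \<circ> \<sigma>) (\<rho> \<circ> \<tau>) = perm_dist \<sigma> \<tau>"
  using assms by (simp add: perm_dist_eq symgrp_inf_comp inv_comp_comp symgrp_inf_bij)

lemma perm_norm_inv_comp_le:
  assumes "\<sigma> \<in> symgrp_inf" "\<tau> \<in> symgrp_inf"
  shows "perm_norm (inv \<sigma> \<circ> \<tau>) \<le> perm_norm \<sigma> + perm_norm \<tau>"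
  using perm_norm_comp_le[OF symgrp_inf_inv[OF assms(1)] assms(2)]
  by (simp add: perm_norm_inv assms)

lemma perm_dist_commute: "perm_dist \<sigma> \<tau> = perm_dist \<tau> \<sigma>"
proof (cases "\<sigma> \<in> symgrp_inf \<and> \<tau> \<in> symgrp_inf")
  case True
  \<comment> \<open>The two distances are norms of mutually inverse permutations. Outside the
    carrier both take the default value 0.\<close>
  then have "inv (inv \<sigma> \<circ> \<tau>) = inv \<tau> \<circ> \<sigma>"
    by (simp add: o_inv_distrib bij_imp_bij_inv symgrp_inf_bij inv_inv_eq)
  with True perm_norm_inv[of "inv \<sigma> \<circ> \<tau>"] show ?thesis
    by (simp add: perm_dist_eq symgrp_inf_comp symgrp_inf_inv)
qed (auto simp: perm_dist_def)

lemma Metric_space_perm_dist: "Metric_space symgrp_inf perm_dist"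
proof
  fix \<sigma> \<tau> :: "nat \<Rightarrow> nat"
  show "0 \<le> perm_dist \<sigma> \<tau>"
    by (simp add: perm_dist_def perm_norm_eq_card(1) symgrp_inf_comp symgrp_inf_inv)
  show "perm_dist \<sigma> \<tau> = perm_dist \<tau> \<sigma>" by (rule perm_dist_commute)
next
  fix \<sigma> \<tau> assume in_inf: "\<sigma> \<in> symgrp_inf" "\<tau> \<in> symgrp_inf"
  have "inv \<sigma> (\<tau> x) = x \<longleftrightarrow> \<sigma> x = \<tau> x" for x
    using bij_inv_eq_iff[OF symgrp_inf_bij[OF in_inf(1)], of x "\<tau> x"] by (simp add: eq_commute)
  then have "inv \<sigma> \<circ> \<tau> = id \<longleftrightarrow> \<sigma> = \<tau>"
    by (simp add: fun_eq_iff)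
  then show "perm_dist \<sigma> \<tau> = 0 \<longleftrightarrow> \<sigma> = \<tau>"
    using in_inf by (simp add: perm_dist_eq perm_norm_eq_0_iff symgrp_inf_comp symgrp_inf_inv)
next
  fix \<sigma> \<rho> \<tau> assume in_inf: "\<sigma> \<in> symgrp_inf" "\<rho> \<in> symgrp_inf" "\<tau> \<in> symgrp_inf"
  \<comment> \<open>Inserting \<open>\<rho> \<circ> inv \<rho>\<close> reduces the triangle
    inequality to subadditivity of the norm.\<close>
  have "inv \<sigma> \<circ> \<tau> = (inv \<sigma> \<circ> \<rho>) \<circ> (inv \<rho> \<circ> \<tau>)"
    using symgrp_inf_bij[OF in_inf(2)] by (simp add: fun_eq_iff surj_f_inv_f bij_is_surj)
  then show "perm_dist \<sigma> \<tau> \<le> perm_dist \<sigma> \<rho> + perm_dist \<rho> \<tau>"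
    using perm_norm_comp_le[of "inv \<sigma> \<circ> \<rho>" "inv \<rho> \<circ> \<tau>"] in_inf
    by (simp add: perm_dist_eq symgrp_inf_comp symgrp_inf_inv)
qed

theorem theorem6:
  fixes G :: "(nat \<Rightarrow> nat) set"
  assumes "G = symgrp_inf \<or> (\<exists>n. G = symgrp n)"
  shows "perm_norm id = 0
    \<and> (\<forall>\<sigma>\<in>G. perm_norm \<sigma> = perm_norm (inv \<sigma>))
    \<and> (\<forall>\<sigma>\<in>G. \<forall>\<tau>\<in>G. perm_norm (inv \<sigma> \<circ> \<tau>) \<le> perm_norm \<sigma> + perm_norm \<tau>)
    \<and> Metric_space G perm_dist
    \<and> (\<forall>\<rho>\<in>G. \<forall>\<sigma>\<in>G. \<forall>\<tau>\<in>G. perm_dist (\<rho> \<circ> \<sigma>) (\<rho> \<circ> \<tau>) = perm_dist \<sigma> \<tau>)"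
proof -
  \<comment> \<open>The norm and the distance on \<open>S(n)\<close> are restrictions of those on
    the union, so all claims are inherited by subsets.\<close>
  have G: "G \<subseteq> symgrp_inf" using assms symgrp_subset_inf by auto
  then have "\<sigma> \<in> symgrp_inf" if "\<sigma> \<in> G" for \<sigma> using that by blast
  then show ?thesis
    using Metric_space.subspace[OF Metric_space_perm_dist G]
    by (simp add: perm_norm_id perm_norm_inv perm_norm_inv_comp_le perm_dist_left_invariant)
qed

end
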